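(* For every integer $m$, let $LG_{-1}(m)$ denote the number of signed partitions of $m$ in which the positive parts are at least $5$, odd and differ pairwise by at least $4$, and the negative parts are distinct, odd, and each at most $2\ell^++1$, where $\ell^+$ is the number of positive parts. For every nonnegative integer $n$, let $LG_1(n)$ denote the number of partitions of $n$ in which any two consecutive parts differ by at least $2$, and by at least $4$ if both are odd. Then $LG_1(n)=LG_{-1}(n-1)$ for all $n\ge 0$.
   Context: A partition of an integer $n$ is a finite nonincreasing sequence of positive integers (its parts) summing to $n$. A signed partition of an integer $m$ (possibly negative) is a pair $(\pi,\nu)$ of ordinary partitions with $|\pi|-|\nu|=m$, where $|\cdot|$ denotes the sum of parts; the parts of $\pi$ are the positive parts and the parts of $\nu$ are the negative parts (their sizes). $\ell^+$ denotes the number of positive parts of a signed partition. *)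

theory Defs
  imports Main
begin

definition is_partition :: "nat list \<Rightarrow> bool" where
  "is_partition xs \<longleftrightarrow> sorted_wrt (\<ge>) xs \<and> (\<forall>x \<in> set xs. 0 < x)"

definition partitions_of :: "nat \<Rightarrow> nat list set" where
  "partitions_of n = {xs. is_partition xs \<and> sum_list xs = n}"

definition signed_partitions_of :: "int \<Rightarrow> (nat list \<times> nat list) set" where
  "signed_partitions_of m =
     {(\<pi>, \<nu>). is_partition \<pi> \<and> is_partition \<nu> \<and> int (sum_list \<pi>) - int (sum_list \<nu>) = m}"

(* successively relates adjacent entries only; lists are nonincreasing, so the
   first argument of the relation is the larger of two consecutive parts. *)
definition LG_1 :: "nat \<Rightarrow> nat" where
  "LG_1 n = card {xs \<in> partitions_of n.
     successively (\<lambda>x y. x \<ge> y + 2 \<and> (odd x \<and> odd y \<longrightarrow> x \<ge> y + 4)) xs}"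

(* sorted_wrt relates the entries at all positions i < j.  The set counted is
   finite although signed_partitions_of m is not: if k is the number of positive
   parts, then |\<pi>| - |\<nu>| is at least k * (2 * k + 3) - (k + 1)^2 = k^2 + k - 1,
   so k and |\<nu>|, and hence |\<pi>|, are bounded for given m. *)
definition LG_minus_1 :: "int \<Rightarrow> nat" where
  "LG_minus_1 m = card {(\<pi>, \<nu>) \<in> signed_partitions_of m.
     (\<forall>p \<in> set \<pi>. 5 \<le> p \<and> odd p) \<and> sorted_wrt (\<lambda>x y. x \<ge> y + 4) \<pi> \<and>
     distinct \<nu> \<and> (\<forall>q \<in> set \<nu>. odd q \<and> q \<le> 2 * length \<pi> + 1)}"

end

theory Submission
  imports Defs
begin

text \<open>
  Append a part \<open>0\<close> to every partition counted by \<open>LG_1\<close> that has no part \<open>1\<close>; the partitions then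
  correspond to sequences \<open>z\<^sub>1 > \<dots> > z\<^sub>k\<^sub>+\<^sub>1\<close> with the same gap conditions and \<open>z\<^sub>k\<^sub>+\<^sub>1 \<in> {0, 1}\<close>.
  Every even entry \<open>z\<^sub>j\<close> is made odd by adding \<open>1\<close>, moreover adds \<open>2\<close> to each of the \<open>j - 1\<close> entries
  before it, and is recorded as a negative part \<open>2 * j - 1\<close>; this does not change the sum.
  Dropping the last entry, now always \<open>1\<close>, leaves the positive parts.
  The gap condition on \<open>z\<close> turns exactly into the condition that the positive parts are odd, at
  least \<open>5\<close> and at least \<open>4\<close> apart, while the parities of the entries can be read off from the
  negative parts.
\<close>

section \<open>Encoding gap sequences as signed partitions\<close>

abbreviation goellnitz_gap :: "nat \<Rightarrow> nat \<Rightarrow> bool" where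
  "goellnitz_gap x y \<equiv> x \<ge> y + 2 \<and> (odd x \<and> odd y \<longrightarrow> x \<ge> y + 4)"

text \<open>Prefixing \<open>x\<close> raises every index by one, so each recorded
  \<open>2 * j - 1\<close> grows by \<open>2\<close>; an even \<open>x\<close>, now at index
  \<open>1\<close>, is recorded as \<open>1\<close>. The parts come out in decreasing order.\<close>

fun negative_parts :: "nat list \<Rightarrow> nat list" where
  "negative_parts [] = []"
| "negative_parts (x # zs) =
     map (\<lambda>q. q + 2) (negative_parts zs) @ (if even x then [1] else [])"

text \<open>\<open>length (negative_parts (y # zs))\<close> counts the even entries after
  \<open>x\<close>, each of which adds \<open>2\<close> to \<open>x\<close>.\<close>

fun positive_parts :: "nat list \<Rightarrow> nat list" where
  "positive_parts [] = []"
| "positive_parts [x] = []"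
| "positive_parts (x # y # zs) =
     (x + of_bool (even x) + 2 * length (negative_parts (y # zs))) # positive_parts (y # zs)"

definition gap_sequence :: "nat list \<Rightarrow> bool" where
  "gap_sequence zs \<longleftrightarrow> zs \<noteq> [] \<and> last zs \<le> 1 \<and> successively goellnitz_gap zs"

definition admissible_positive :: "nat list \<Rightarrow> bool" where
  "admissible_positive ps \<longleftrightarrow> (\<forall>p \<in> set ps. 5 \<le> p \<and> odd p) \<and> successively (\<lambda>x y. x \<ge> y + 4) ps"

text \<open>\<open>k\<close> stands for the length of the gap sequence, one more than the number of
  positive parts.\<close>

definition admissible_negative :: "nat \<Rightarrow> nat list \<Rightarrow> bool" where
  "admissible_negative k qs \<longleftrightarrow> sorted_wrt (>) qs \<and> (\<forall>q \<in> set qs. odd q \<and> q < 2 * k)"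

lemma gap_sequence_singleton: "gap_sequence [x] \<longleftrightarrow> x \<le> 1"
  by (simp add: gap_sequence_def)

lemma gap_sequence_Cons_Cons:
  "gap_sequence (x # y # zs) \<longleftrightarrow> goellnitz_gap x y \<and> gap_sequence (y # zs)"
  by (auto simp: gap_sequence_def)

lemma admissible_positive_Cons:
  "admissible_positive (p # ps) \<longleftrightarrow>
     5 \<le> p \<and> odd p \<and> (ps \<noteq> [] \<longrightarrow> p \<ge> hd ps + 4) \<and> admissible_positive ps"
  by (auto simp: admissible_positive_def successively_Cons)

lemma length_positive_parts: "length (positive_parts zs) = length zs - 1"
  by (induction zs rule: positive_parts.induct) auto

lemma admissible_negative_parts: "admissible_negative (length zs) (negative_parts zs)"
proof (induction zs)
  case Nil
  then show ?case by (simp add: admissible_negative_def)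
next
  case (Cons x zs)
  then show ?case
    by (auto simp: admissible_negative_def sorted_wrt_append sorted_wrt_map)
qed

text \<open>The \<open>1\<close> on the left is the dropped last entry after it was made odd.
  Prefixing \<open>x\<close> adds \<open>2\<close> to every old negative part, which matches the
  term \<open>2 * length\<close> in the new positive part.\<close>

lemma sum_list_positive_parts:
  assumes "gap_sequence zs"
  shows "sum_list (positive_parts zs) + 1 = sum_list zs + sum_list (negative_parts zs)"
  using assms
proof (induction zs rule: positive_parts.induct)
  case (2 x)
  then have "x = 0 \<or> x = 1" by (auto simp: gap_sequence_singleton)
  then show ?case by auto
next
  case (3 x y zs)
  have *: "sum_list (map (\<lambda>q. q + 2) qs) = sum_list qs + 2 * length qs" for qs :: "nat list"
    by (induction qs) auto
  have "sum_list (negative_parts (x # y # zs)) =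
      sum_list (negative_parts (y # zs)) + 2 * length (negative_parts (y # zs)) + of_bool (even x)"
    by (simp only: negative_parts.simps(2)[of x] sum_list_append *) simp
  with 3 show ?case
    by (simp add: gap_sequence_Cons_Cons del: negative_parts.simps)
qed (simp add: gap_sequence_def)

section \<open>The gap condition in terms of positive parts\<close>

text \<open>The right side compares the positive parts arising from \<open>x\<close> and
  \<open>y\<close>: the same later even entries raise both, but an even \<open>y\<close> raises only
  the one from \<open>x\<close>. If the parities differ, \<open>x - y\<close> is odd, so a gap of
  \<open>2\<close> is already one of \<open>3\<close>.\<close>

lemma goellnitz_gap_iff:
  "goellnitz_gap x y \<longleftrightarrow> x + of_bool (even x) + 2 * of_bool (even y) \<ge> y + of_bool (even y) + 4"
  by (cases "even x"; cases "even y") (auto, presburger+)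

lemma positive_parts_Cons_hd:
  "positive_parts (y # z # zs) \<noteq> [] \<and>
   hd (positive_parts (y # z # zs)) + 2 * of_bool (even y) =
     y + of_bool (even y) + 2 * length (negative_parts (y # z # zs))"
  by simp

text \<open>An equivalence, since one direction yields admissible positive parts and the other
  reconstructs the gaps.\<close>

lemma admissible_positive_parts_Cons_Cons:
  assumes "gap_sequence (y # zs)" and "admissible_positive (positive_parts (y # zs))"
  shows "admissible_positive (positive_parts (x # y # zs)) \<longleftrightarrow> goellnitz_gap x y"
proof (cases zs)
  case Nil
  \<comment> \<open>The dropped part would be \<open>1\<close>, so the lower bound \<open>5\<close>
    is the distance \<open>4\<close> from it.\<close>
  with assms have "y = 0 \<or> y = 1" by (auto simp: gap_sequence_singleton)
  then show ?thesis
    using Nil by (auto simp: admissible_positive_def) presburger+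
next
  case (Cons z zs')
  have "5 \<le> hd (positive_parts (y # zs))"
    using assms(2) Cons by (simp add: admissible_positive_Cons)
  then show ?thesis
    using assms(2) positive_parts_Cons_hd[of y z zs'] unfolding Cons goellnitz_gap_iff
    by (auto simp: admissible_positive_Cons)
qed

lemma admissible_positive_parts:
  assumes "gap_sequence zs"
  shows "admissible_positive (positive_parts zs)"
  using assms
proof (induction zs rule: positive_parts.induct)
  case (3 x y zs)
  then show ?case
    using admissible_positive_parts_Cons_Cons gap_sequence_Cons_Cons by blast
qed (simp_all add: admissible_positive_def)

section \<open>Recovering a gap sequence from its image\<close>

text \<open>Shifted parts are at least \<open>2\<close>, so \<open>1\<close> occurs exactly when the
  head is even.\<close>

lemma negative_parts_Cons_eq:
  "negative_parts (x # zs) = negative_parts (x' # zs') \<longleftrightarrow>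
     (even x \<longleftrightarrow> even x') \<and> negative_parts zs = negative_parts zs'"
proof -
  have inj: "inj (\<lambda>q::nat. q + 2)" by (simp add: inj_def)
  have no_one: "1 \<notin> set (map (\<lambda>q::nat. q + 2) qs)" for qs by auto
  have "even x \<longleftrightarrow> 1 \<in> set (negative_parts (x # zs))" for x zs
    using no_one by simp
  then have "even x \<longleftrightarrow> even x'" if "negative_parts (x # zs) = negative_parts (x' # zs')"
    using that by metis
  then show ?thesis
    using inj by (auto simp: inj_map_eq_map)
qed

text \<open>The negative parts reveal the parities, hence the amount to subtract from each positive
  part.\<close>

lemma inj_on_parts: "inj_on (\<lambda>zs. (positive_parts zs, negative_parts zs)) {zs. gap_sequence zs}"
proof -
  have "zs = zs'"
    if "gap_sequence zs" "gap_sequence zs'" "positive_parts zs = positive_parts zs'"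
      "negative_parts zs = negative_parts zs'" for zs zs'
    using that
  proof (induction zs arbitrary: zs' rule: positive_parts.induct)
    case 1
    then show ?case by (simp add: gap_sequence_def)
  next
    case (2 x)
    then obtain x' where "zs' = [x']"
      by (cases zs' rule: positive_parts.cases) (auto simp: gap_sequence_def)
    with 2 show ?case
      by (auto simp: gap_sequence_singleton le_Suc_eq split: if_splits)
  next
    case (3 x y zs)
    then obtain x' y' ws where zs': "zs' = x' # y' # ws"
      by (cases zs' rule: positive_parts.cases) auto
    have par: "even x \<longleftrightarrow> even x'" and neg: "negative_parts (y # zs) = negative_parts (y' # ws)"
      using "3.prems"(4) unfolding zs' negative_parts_Cons_eq[of x] by auto
    moreover have "positive_parts (y # zs) = positive_parts (y' # ws)"
      and eq: "x + of_bool (even x) + 2 * length (negative_parts (y # zs)) =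
          x' + of_bool (even x') + 2 * length (negative_parts (y' # ws))"
      using "3.prems"(3) unfolding zs' by (simp_all del: negative_parts.simps)
    ultimately have "y # zs = y' # ws"
      using "3.IH" "3.prems"(1,2) unfolding zs' gap_sequence_Cons_Cons by blast
    moreover have "x = x'"
      using eq par neg by (simp del: negative_parts.simps)
    ultimately show ?case using zs' by simp
  qed
  then show ?thesis by (auto simp: inj_on_def)
qed

text \<open>Inverts one recursion step of \<open>negative_parts\<close>, with \<open>b\<close>
  standing for an even head.\<close>

lemma admissible_negative_Suc_cases:
  assumes "admissible_negative (Suc k) qs"
  obtains b rs where "admissible_negative k rs"
    and "qs = map (\<lambda>q. q + 2) rs @ (if b then [1] else [])"
proof -
  have shift: "\<exists>rs. admissible_negative k rs \<and> ss = map (\<lambda>q. q + 2) rs"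
    if "admissible_negative (Suc k) ss" "1 \<notin> set ss" for ss
  proof (intro exI conjI)
    \<comment> \<open>An odd entry other than \<open>1\<close> is at least \<open>3\<close>, so
      subtracting \<open>2\<close> does not truncate.\<close>
    have ge: "q \<ge> 3 \<and> odd q \<and> q < 2 * Suc k" if "q \<in> set ss" for q
    proof -
      have "odd q" "q \<noteq> 1" "q < 2 * Suc k"
        using that \<open>1 \<notin> set ss\<close> \<open>admissible_negative (Suc k) ss\<close>
        by (auto simp: admissible_negative_def)
      then show ?thesis by presburger
    qed
    have "sorted_wrt (>) ss"
      using that(1) by (simp add: admissible_negative_def)
    then have "sorted_wrt (\<lambda>x y. x - 2 > y - 2) ss"
    proof (rule sorted_wrt_mono_rel[rotated])
      fix x y assume "x \<in> set ss" "y \<in> set ss" "x > y"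
      then show "x - 2 > y - 2" using ge[of y] by linarith
    qed
    moreover have "odd (q - 2) \<and> q - 2 < 2 * k" if "q \<in> set ss" for q
      using ge[OF that] by auto
    ultimately show "admissible_negative k (map (\<lambda>q. q - 2) ss)"
      by (auto simp: admissible_negative_def sorted_wrt_map)
    have "q - 2 + 2 = q" if "q \<in> set ss" for q
      using ge[OF that] by linarith
    then show "ss = map (\<lambda>q. q + 2) (map (\<lambda>q. q - 2) ss)"
      by (simp only: map_map o_def map_idI)
  qed
  show ?thesis
  proof (cases "1 \<in> set qs")
    case False
    then obtain rs where "admissible_negative k rs" "qs = map (\<lambda>q. q + 2) rs"
      using shift assms by blast
    then show ?thesis using that[of rs False] by simp
  next
    case True
    then obtain ss s where qs: "qs = ss @ [s]" by (cases qs rule: rev_cases) auto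
    have "odd s" and less: "\<forall>q \<in> set ss. s < q" and "admissible_negative (Suc k) ss"
      using assms by (auto simp: qs admissible_negative_def sorted_wrt_append)
    \<comment> \<open>All other entries exceed \<open>s\<close>, and \<open>s\<close> is odd, hence
      positive; so \<open>1\<close> can only be \<open>s\<close>.\<close>
    moreover have "s = 1" "1 \<notin> set ss"
      using True \<open>odd s\<close> less by (auto simp: qs dest: odd_pos)
    ultimately show ?thesis using shift[of ss] that[of _ True] qs by auto
  qed
qed

lemma ex_gap_sequence:
  assumes "admissible_positive ps" "admissible_negative (Suc (length ps)) qs"
  shows "\<exists>zs. gap_sequence zs \<and> positive_parts zs = ps \<and> negative_parts zs = qs"
  using assms
proof (induction ps arbitrary: qs)
  case Nil
  then obtain b where "qs = (if b then [1] else [])"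
    by (elim admissible_negative_Suc_cases) (auto simp: admissible_negative_def)
  then show ?case
    \<comment> \<open>The single entry is \<open>0\<close> if \<open>1\<close> is a negative part
      and \<open>1\<close> otherwise.\<close>
    by (intro exI[of _ "[of_bool (\<not> b)]"]) (auto simp: gap_sequence_singleton)
next
  case (Cons p ps)
  from Cons.prems(2) obtain b rs where rs: "admissible_negative (Suc (length ps)) rs"
    and qs: "qs = map (\<lambda>q. q + 2) rs @ (if b then [1] else [])"
    by (auto elim: admissible_negative_Suc_cases)
  have p: "admissible_positive ps" "5 \<le> p" "odd p" "ps \<noteq> [] \<Longrightarrow> p \<ge> hd ps + 4"
    using Cons.prems(1) by (auto simp: admissible_positive_Cons)
  then obtain zs where zs: "gap_sequence zs" "positive_parts zs = ps" "negative_parts zs = rs"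
    using Cons.IH[OF _ rs] by auto
  then obtain y ws where yws: "zs = y # ws"
    by (cases zs) (auto simp: gap_sequence_def)
  \<comment> \<open>This keeps the subtraction defining \<open>x\<close> below from
    truncating.\<close>
  have le: "2 * length rs + 1 \<le> p"
  proof (cases ws)
    case Nil
    then have "length rs \<le> 1" using zs(3) yws by auto
    then show ?thesis using p(2) by simp
  next
    case (Cons z ws')
    then show ?thesis
      using positive_parts_Cons_hd[of y z ws'] zs(2,3) yws p(4)
      by (cases "even y") auto
  qed
  \<comment> \<open>Solves the recursion of \<open>positive_parts\<close> for the head; as
    \<open>p\<close> is odd, \<open>x\<close> gets the parity that \<open>b\<close> demands.\<close>
  define x where "x = p - of_bool b - 2 * length rs"
  have x: "even x \<longleftrightarrow> b" "x + of_bool b + 2 * length rs = p"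
    using le p(3) by (auto simp: x_def)
  have pos: "positive_parts (x # zs) = p # ps"
    using x zs(2,3) unfolding yws by (simp del: negative_parts.simps)
  have neg: "negative_parts (x # zs) = qs"
    using x(1) zs(3) qs by simp
  have "goellnitz_gap x y"
    using admissible_positive_parts_Cons_Cons[of y ws x] zs p(1) pos Cons.prems(1) yws by metis
  then have "gap_sequence (x # zs)"
    using zs(1) unfolding yws gap_sequence_Cons_Cons by simp
  with pos neg show ?case by blast
qed

section \<open>Reformulating the two counts\<close>

lemma LG_1_eq_card_gap_sequences: "LG_1 n = card {zs. gap_sequence zs \<and> sum_list zs = n}"
proof -
  let ?A = "{xs \<in> partitions_of n. successively goellnitz_gap xs}"
  let ?B = "{zs. gap_sequence zs \<and> sum_list zs = n}"
  \<comment> \<open>The empty partition, for which \<open>last\<close> is unspecified, must go to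
    \<open>[0]\<close>.\<close>
  let ?f = "\<lambda>xs. if xs \<noteq> [] \<and> last xs = 1 then xs else xs @ [0]"
  let ?g = "\<lambda>zs. if last zs = 1 then zs else butlast zs"
  have pos: "sorted_wrt (\<ge>) zs \<and> (\<forall>x \<in> set (butlast zs). 0 < x)"
    if "successively goellnitz_gap zs" for zs
  proof -
    have "successively (>) zs"
      using that by (rule successively_mono) auto
    then have *: "sorted_wrt (>) zs"
      by (subst (asm) successively_conv_sorted_wrt) (auto simp: transp_on_def)
    then have "sorted_wrt (\<ge>) zs"
      by (rule sorted_wrt_mono_rel[rotated]) auto
    moreover have "\<forall>x \<in> set (butlast zs). 0 < x"
      using * by (cases zs rule: rev_cases) (auto simp: sorted_wrt_append)
    ultimately show ?thesis by simp
  qed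
  have "bij_betw ?f ?A ?B"
  proof (rule bij_betw_byWitness[where f' = ?g])
    show "\<forall>xs \<in> ?A. ?g (?f xs) = xs" by auto
    show "\<forall>zs \<in> ?B. ?f (?g zs) = zs"
    proof
      fix zs assume "zs \<in> ?B"
      then obtain ws c where zs: "zs = ws @ [c]" and "c \<le> 1" "successively goellnitz_gap zs"
        by (cases zs rule: rev_cases) (auto simp: gap_sequence_def)
      \<comment> \<open>An entry before a final \<open>0\<close> is at least \<open>2\<close>, so
        \<open>?f\<close> appends the \<open>0\<close> again.\<close>
      then show "?f (?g zs) = zs"
        by (auto simp: successively_append_iff le_Suc_eq)
    qed
    show "?f ` ?A \<subseteq> ?B"
    proof
      fix zs assume "zs \<in> ?f ` ?A"
      then obtain xs where xs: "xs \<in> ?A" and zs: "zs = ?f xs" by blast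
      have "xs = [] \<or> last xs > 0"
        using xs by (cases xs rule: rev_cases) (auto simp: partitions_of_def is_partition_def)
      then show "zs \<in> ?B"
        using xs by (auto simp: zs gap_sequence_def partitions_of_def successively_append_iff)
    qed
    show "?g ` ?B \<subseteq> ?A"
    proof
      fix xs assume "xs \<in> ?g ` ?B"
      then obtain zs where z: "zs \<in> ?B" and xs: "xs = ?g zs" by blast
      then obtain ws c where zs: "zs = ws @ [c]" and c: "c = 0 \<or> c = 1"
        by (cases zs rule: rev_cases) (auto simp: gap_sequence_def le_Suc_eq)
      have gaps: "successively goellnitz_gap zs" and sum: "sum_list zs = n"
        using z by (simp_all add: gap_sequence_def)
      have "sorted_wrt (\<ge>) zs" "\<forall>x \<in> set ws. 0 < x"
        using pos[OF gaps] by (simp_all add: zs)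
      moreover have "successively goellnitz_gap ws"
        using gaps by (simp add: zs successively_append_iff)
      ultimately show "xs \<in> ?A"
        using c gaps sum
        by (elim disjE) (simp_all add: xs zs partitions_of_def is_partition_def sorted_wrt_append)
    qed
  qed
  then show ?thesis by (simp add: LG_1_def bij_betw_same_card)
qed

text \<open>The gap of \<open>4\<close> is transitive, so it may be tested on consecutive parts
  only; nonincreasing and distinct together mean strictly decreasing, and odd parts are
  positive.\<close>

lemma LG_minus_1_eq_card_admissible:
  "LG_minus_1 m = card {(ps, qs). admissible_positive ps \<and>
     admissible_negative (Suc (length ps)) qs \<and> int (sum_list ps) - int (sum_list qs) = m}"
proof -
  have pos: "is_partition ps \<and> (\<forall>p \<in> set ps. 5 \<le> p \<and> odd p) \<and> sorted_wrt (\<lambda>x y. x \<ge> y + 4) ps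
      \<longleftrightarrow> admissible_positive ps" for ps
  proof -
    have "successively (\<lambda>x y. x \<ge> y + 4) ps = sorted_wrt (\<lambda>x y. x \<ge> y + 4) ps"
      by (rule successively_conv_sorted_wrt) (auto simp: transp_on_def)
    moreover have "sorted_wrt (\<ge>) ps" if "sorted_wrt (\<lambda>x y. x \<ge> y + 4) ps"
      using that by (rule sorted_wrt_mono_rel[rotated]) auto
    ultimately show ?thesis
      by (fastforce simp: is_partition_def admissible_positive_def)
  qed
  have strict: "sorted_wrt (\<ge>) qs \<and> distinct qs \<longleftrightarrow> sorted_wrt (>) qs" for qs :: "nat list"
    by (induction qs) (auto simp: less_le)
  have neg: "is_partition qs \<and> distinct qs \<and> (\<forall>q \<in> set qs. odd q \<and> q \<le> 2 * k + 1)
      \<longleftrightarrow> admissible_negative (Suc k) qs" for qs k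
  proof -
    have "q \<le> 2 * k + 1 \<longleftrightarrow> q < 2 * Suc k" for q
      by auto
    moreover have "(\<forall>q \<in> set qs. 0 < q)" if "\<forall>q \<in> set qs. odd q \<and> q < 2 * Suc k"
      using that by (blast intro: odd_pos)
    ultimately show ?thesis
      unfolding is_partition_def admissible_negative_def strict[symmetric] by auto
  qed
  show ?thesis
    unfolding LG_minus_1_def signed_partitions_of_def pos[symmetric] neg[symmetric]
    by (rule arg_cong[of _ _ card]) blast
qed

theorem theorem5p3:
  fixes n :: nat
  shows "LG_1 n = LG_minus_1 (int n - 1)"
proof -
  let ?F = "\<lambda>zs. (positive_parts zs, negative_parts zs)"
  let ?B = "{zs. gap_sequence zs \<and> sum_list zs = n}"
  let ?C = "{(ps, qs). admissible_positive ps \<and>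
     admissible_negative (Suc (length ps)) qs \<and> int (sum_list ps) - int (sum_list qs) = int n - 1}"
  have sum: "int (sum_list (positive_parts zs)) - int (sum_list (negative_parts zs)) =
      int (sum_list zs) - 1" if "gap_sequence zs" for zs
    using sum_list_positive_parts[OF that] by linarith
  have neg: "admissible_negative (Suc (length (positive_parts zs))) (negative_parts zs)"
    if "gap_sequence zs" for zs
    using that admissible_negative_parts[of zs]
    by (simp add: length_positive_parts gap_sequence_def)
  have "bij_betw ?F ?B ?C"
    unfolding bij_betw_def
  proof
    show "inj_on ?F ?B" by (rule inj_on_subset[OF inj_on_parts]) auto
    show "?F ` ?B = ?C"
    proof
      show "?F ` ?B \<subseteq> ?C"
        using sum neg admissible_positive_parts by auto
      show "?C \<subseteq> ?F ` ?B"
      proof clarify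
        fix ps qs assume "admissible_positive ps" "admissible_negative (Suc (length ps)) qs"
          and s: "int (sum_list ps) - int (sum_list qs) = int n - 1"
        then obtain zs where "gap_sequence zs" "positive_parts zs = ps" "negative_parts zs = qs"
          using ex_gap_sequence by blast
        with s sum[of zs] show "(ps, qs) \<in> ?F ` ?B" by auto
      qed
    qed
  qed
  then show ?thesis
    by (simp add: LG_1_eq_card_gap_sequences LG_minus_1_eq_card_admissible bij_betw_same_card)
qed

end
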